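(* Consider the aggregate-and-iterative-disaggregate (AID) algorithm for the (linear kernel, soft margin) support vector machine with data $x_i\in\mathbb{R}^m$, $y_i\in\{-1,1\}$, $i\in I=\{1,\dots,n\}$, and penalty $M>0$, with optimal aggregated values $F^t$, original objective values $E^t$, and last iteration $T$. Then $F^{t-1}\le F^t$ for $t=1,\dots,T$. Further, $F^T=E^T=E^*$, where $$E^*=\min_{w,b,\xi}\ \tfrac12\|w\|^2+M\|\xi\|_1\quad\text{s.t. } y_i(wx_i+b)\ge1-\xi_i,\ \xi_i\ge0,\ i\in I .$$
   Context: Here $w\in\mathbb{R}^m$, $b\in\mathbb{R}$, $wx_i$ is the Euclidean inner product and $\|\cdot\|$ the Euclidean norm. The algorithm starts from an arbitrary partition $C^0$ of $I$ into nonempty clusters such that all entries in a cluster have the same label $y_i$. In iteration $t$, given the partition $C^t=\{C_k^t\}_{k\in K^t}$, set $x_k^t=\frac{1}{|C_k^t|}\sum_{i\in C_k^t}x_i$ and $y_k^t=\frac{1}{|C_k^t|}\sum_{i\in C_k^t}y_i\in\{-1,1\}$. Let $$F^t=\min_{w\in\mathbb{R}^m,\,b\in\mathbb{R},\,\xi\in\mathbb{R}_+^{|K^t|}}\ \tfrac12\|w\|^2+M\sum_{k\in K^t}|C_k^t|\xi_k\quad\text{s.t. } y_k^t(wx_k^t+b)\ge1-\xi_k,\ k\in K^t,$$ let $(\bar w^t,\bar b^t,\bar\xi^t)$ be an optimal solution, put $\hat w^t=\bar w^t$, $\hat b^t=\bar b^t$, $\hat\xi_i^t=\max\{0,1-y_i(\bar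 w^tx_i+\bar b^t)\}$ for $i\in I$, and let $E^t=\tfrac12\|\hat w^t\|^2+M\|\hat\xi^t\|_1$. Optimality condition: for all $k\in K^t$, either (i) $1-y_i(\bar w^tx_i+\bar b^t)\le0$ for all $i\in C_k^t$, or (ii) $1-y_i(\bar w^tx_i+\bar b^t)>0$ for all $i\in C_k^t$. If it holds, the algorithm stops and $T:=t$. Otherwise $C^{t+1}$ is obtained from $C^t$ by keeping every cluster satisfying (i) or (ii) and replacing every other cluster $C_k^t$ by the two clusters $\{i\in C_k^t:1-y_i(\bar w^tx_i+\bar b^t)>0\}$ and $\{i\in C_k^t:1-y_i(\bar w^tx_i+\bar b^t)\le0\}$. *)

theory Defs
  imports "HOL-Analysis.Analysis"
begin

text \<open>
  Entries are indexed by \<open>{1..n}\<close>, and the label values \<open>-1\<close>, \<open>1\<close> are taken in the reals. A partition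
  is a set of sets of entries; each cluster serves as its own index, so the slack variables of an
  aggregated problem form a function on clusters, of which only the values on the current partition
  are relevant.
\<close>

text \<open>The minimum of \<open>f\<close> over \<open>P\<close>; meaningful only if the minimum is attained.\<close>

definition min_value :: "('a \<Rightarrow> real) \<Rightarrow> ('a \<Rightarrow> bool) \<Rightarrow> real" where
  "min_value f P = (LEAST v. \<exists>z. P z \<and> f z = v)"

definition margin_violation ::
  "(nat \<Rightarrow> real ^ 'm) \<Rightarrow> (nat \<Rightarrow> real) \<Rightarrow> real ^ 'm \<Rightarrow> real \<Rightarrow> nat \<Rightarrow> real" where
  "margin_violation x y w b i = 1 - y i * (w \<bullet> x i + b)"

definition svm_feasible ::
  "nat \<Rightarrow> (nat \<Rightarrow> real ^ 'm) \<Rightarrow> (nat \<Rightarrow> real) \<Rightarrow> (real ^ 'm) \<times> real \<times> (nat \<Rightarrow> real) \<Rightarrow> bool" where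
  "svm_feasible n x y = (\<lambda>(w, b, \<xi>).
     \<forall>i\<in>{1..n}. y i * (w \<bullet> x i + b) \<ge> 1 - \<xi> i \<and> \<xi> i \<ge> 0)"

definition svm_objective ::
  "nat \<Rightarrow> real \<Rightarrow> (real ^ 'm) \<times> real \<times> (nat \<Rightarrow> real) \<Rightarrow> real" where
  "svm_objective n M = (\<lambda>(w, b, \<xi>). 1 / 2 * (norm w)\<^sup>2 + M * (\<Sum>i\<in>{1..n}. \<bar>\<xi> i\<bar>))"

definition cluster_mean :: "(nat \<Rightarrow> 'a::real_vector) \<Rightarrow> nat set \<Rightarrow> 'a" where
  "cluster_mean z k = (1 / real (card k)) *\<^sub>R (\<Sum>i\<in>k. z i)"

definition agg_feasible ::
  "(nat \<Rightarrow> real ^ 'm) \<Rightarrow> (nat \<Rightarrow> real) \<Rightarrow> nat set set \<Rightarrow>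
    (real ^ 'm) \<times> real \<times> (nat set \<Rightarrow> real) \<Rightarrow> bool" where
  "agg_feasible x y C = (\<lambda>(w, b, \<xi>).
     \<forall>k\<in>C. cluster_mean y k * (w \<bullet> cluster_mean x k + b) \<ge> 1 - \<xi> k \<and> \<xi> k \<ge> 0)"

definition agg_objective ::
  "real \<Rightarrow> nat set set \<Rightarrow> (real ^ 'm) \<times> real \<times> (nat set \<Rightarrow> real) \<Rightarrow> real" where
  "agg_objective M C = (\<lambda>(w, b, \<xi>). 1 / 2 * (norm w)\<^sup>2 + M * (\<Sum>k\<in>C. real (card k) * \<xi> k))"

definition one_sided ::
  "(nat \<Rightarrow> real ^ 'm) \<Rightarrow> (nat \<Rightarrow> real) \<Rightarrow> real ^ 'm \<Rightarrow> real \<Rightarrow> nat set \<Rightarrow> bool" where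
  "one_sided x y w b k \<longleftrightarrow>
     (\<forall>i\<in>k. margin_violation x y w b i \<le> 0) \<or> (\<forall>i\<in>k. margin_violation x y w b i > 0)"

definition disaggregate ::
  "(nat \<Rightarrow> real ^ 'm) \<Rightarrow> (nat \<Rightarrow> real) \<Rightarrow> real ^ 'm \<Rightarrow> real \<Rightarrow> nat set set \<Rightarrow> nat set set" where
  "disaggregate x y w b C =
     {k \<in> C. one_sided x y w b k} \<union>
     (\<Union>k\<in>{k \<in> C. \<not> one_sided x y w b k}.
        {{i \<in> k. margin_violation x y w b i > 0}, {i \<in> k. margin_violation x y w b i \<le> 0}})"

text \<open>
  A run that stops in iteration \<open>T\<close>, with partitions \<open>C t\<close> and, for each \<open>t \<le> T\<close>, an arbitrarily chosen
  optimal solution \<open>(w t, b t, \<xi> t)\<close> of the aggregated problem. Values beyond \<open>T\<close> are unconstrained.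
\<close>

definition aid_run ::
  "nat \<Rightarrow> (nat \<Rightarrow> real ^ 'm) \<Rightarrow> (nat \<Rightarrow> real) \<Rightarrow> real \<Rightarrow> (nat \<Rightarrow> nat set set) \<Rightarrow>
    (nat \<Rightarrow> real ^ 'm) \<Rightarrow> (nat \<Rightarrow> real) \<Rightarrow> (nat \<Rightarrow> nat set \<Rightarrow> real) \<Rightarrow> nat \<Rightarrow> bool" where
  "aid_run n x y M C w b \<xi> T \<longleftrightarrow>
     partition_on {1..n} (C 0) \<and>
     (\<forall>k\<in>C 0. \<forall>i\<in>k. \<forall>j\<in>k. y i = y j) \<and>
     (\<forall>t\<le>T. is_arg_min (agg_objective M (C t)) (agg_feasible x y (C t)) (w t, b t, \<xi> t)) \<and>
     (\<forall>t<T. \<not> (\<forall>k\<in>C t. one_sided x y (w t) (b t) k) \<and>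
            C (Suc t) = disaggregate x y (w t) (b t) (C t)) \<and>
     (\<forall>k\<in>C T. one_sided x y (w T) (b T) k)"

definition agg_value ::
  "(nat \<Rightarrow> real ^ 'm) \<Rightarrow> (nat \<Rightarrow> real) \<Rightarrow> real \<Rightarrow> nat set set \<Rightarrow> real" where
  "agg_value x y M C = min_value (agg_objective M C) (agg_feasible x y C)"

definition induced_value ::
  "nat \<Rightarrow> (nat \<Rightarrow> real ^ 'm) \<Rightarrow> (nat \<Rightarrow> real) \<Rightarrow> real \<Rightarrow> real ^ 'm \<Rightarrow> real \<Rightarrow> real" where
  "induced_value n x y M w b =
     svm_objective n M (w, b, \<lambda>i. max 0 (margin_violation x y w b i))"

definition svm_value ::
  "nat \<Rightarrow> (nat \<Rightarrow> real ^ 'm) \<Rightarrow> (nat \<Rightarrow> real) \<Rightarrow> real \<Rightarrow> real" where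
  "svm_value n x y M = min_value (svm_objective n M) (svm_feasible n x y)"

end

theory Submission
  imports Defs
begin

text \<open>
  Eliminating the slack variables turns the aggregated problem for a partition \<open>C\<close> into the
  unconstrained minimization of \<open>\<parallel>w\<parallel>\<^sup>2 / 2 + M * (\<Sum>k\<in>C. max 0 (\<Sum>i\<in>k. v i))\<close>, where \<open>v i\<close> is the
  margin violation of entry \<open>i\<close> at \<open>(w, b)\<close>; the original problem is the case of singleton clusters.
  Since \<open>max 0\<close> is subadditive, refining the partition increases this function pointwise, hence also
  its minimum. On a one-sided cluster \<open>max 0\<close> is additive, so in the last iteration the aggregated
  and the original objective agree at the aggregated optimum; as the former is a lower bound of the
  latter, that optimum solves the original problem.
\<close>

section \<open>Cluster-wise hinge loss and refinement of partitions\<close>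

definition hinge_loss :: "(nat \<Rightarrow> real) \<Rightarrow> nat set set \<Rightarrow> real" where
  "hinge_loss v C = (\<Sum>k\<in>C. max 0 (\<Sum>i\<in>k. v i))"

definition uniform_labels :: "(nat \<Rightarrow> real) \<Rightarrow> nat set set \<Rightarrow> bool" where
  "uniform_labels y C \<longleftrightarrow> (\<forall>k\<in>C. \<forall>i\<in>k. \<forall>j\<in>k. y i = y j)"

lemma uniform_labels_refines:
  assumes "refines A D C" and "uniform_labels y C"
  shows "uniform_labels y D"
  using assms unfolding refines_def uniform_labels_def by (meson subsetD)

text \<open>The \<open>LEAST\<close> in \<open>min_value\<close> is under control only when the
  minimum is attained; a given minimizer supplies exactly that, so every later evaluation goes
  through one.\<close>

lemma min_value_eq:
  assumes "is_arg_min f P z"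
  shows "min_value f P = f z"
  using assms unfolding min_value_def is_arg_min_linorder
  by (intro Least_equality) auto

lemma max_zero_sum_le:
  fixes f :: "'a \<Rightarrow> real"
  shows "max 0 (\<Sum>i\<in>A. f i) \<le> (\<Sum>i\<in>A. max 0 (f i))"
  by (auto intro: sum_mono sum_nonneg)

lemma hinge_loss_refines:
  assumes "finite A" and ref: "refines A D C"
  shows "hinge_loss v C \<le> hinge_loss v D"
proof -
  have C: "partition_on A C" and D: "partition_on A D"
    using ref by (auto simp: refines_def)
  have fin: "finite C" "finite D"
    using finite_elements[OF assms(1)] C D by auto
  \<comment> \<open>\<open>r\<close> sends each fine cluster to a coarse cluster containing it, so
    that a sum over \<open>D\<close> can be grouped by the values of \<open>r\<close>.\<close>
  obtain r where r: "\<And>l. l \<in> D \<Longrightarrow> r l \<in> C \<and> l \<subseteq> r l"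
    using ref unfolding refines_def by metis
  \<comment> \<open>Fine clusters are nonempty and coarse ones disjoint, so the containing cluster
    is unique. This links the pieces of \<open>k\<close>, described by inclusion, to the fibres of
    \<open>r\<close> that \<open>sum.group\<close> expects.\<close>
  have fibre: "{l \<in> D. r l = k} = {l \<in> D. l \<subseteq> k}" if "k \<in> C" for k
  proof -
    have "r l = k" if "l \<in> D" "l \<subseteq> k" for l
    proof (rule ccontr)
      assume "r l \<noteq> k"
      then have "r l \<inter> k = {}"
        using C r[OF \<open>l \<in> D\<close>] \<open>k \<in> C\<close> by (auto simp: partition_on_def disjoint_def)
      then have "l = {}"
        using r that by blast
      then show False
        using D \<open>l \<in> D\<close> by (auto simp: partition_on_def)
    qed
    then show ?thesis
      using r by auto
  qed
  have "hinge_loss v C = (\<Sum>k\<in>C. max 0 (\<Sum>l\<in>{l \<in> D. l \<subseteq> k}. \<Sum>i\<in>l. v i))"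
    unfolding hinge_loss_def
  proof (rule sum.cong[OF refl])
    fix k assume "k \<in> C"
    then have "finite k"
      using C assms(1) by (metis Union_upper finite_subset partition_onD1)
    then show "max 0 (\<Sum>i\<in>k. v i) = max 0 (\<Sum>l\<in>{l \<in> D. l \<subseteq> k}. \<Sum>i\<in>l. v i)"
      using sum.partition[OF _ refines_obtains_subset[OF ref \<open>k \<in> C\<close>]] by metis
  qed
  also have "\<dots> \<le> (\<Sum>k\<in>C. \<Sum>l\<in>{l \<in> D. l \<subseteq> k}. max 0 (\<Sum>i\<in>l. v i))"
    by (intro sum_mono max_zero_sum_le)
  also have "\<dots> = (\<Sum>k\<in>C. \<Sum>l\<in>{l \<in> D. r l = k}. max 0 (\<Sum>i\<in>l. v i))"
    using fibre by (intro sum.cong) auto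
  also have "\<dots> = hinge_loss v D"
    unfolding hinge_loss_def using fin r by (intro sum.group) auto
  finally show ?thesis .
qed

text \<open>The argument for refinements again, with single entries as the finer pieces.\<close>

lemma hinge_loss_le:
  assumes "finite A" and "partition_on A C"
  shows "hinge_loss v C \<le> (\<Sum>i\<in>A. max 0 (v i))"
  unfolding hinge_loss_def sum.partition[OF assms]
  by (intro sum_mono max_zero_sum_le)

lemma hinge_loss_one_sided:
  assumes "finite A" and "partition_on A C" and "\<forall>k\<in>C. one_sided x y w b k"
  shows "hinge_loss (margin_violation x y w b) C
           = (\<Sum>i\<in>A. max 0 (margin_violation x y w b i))"
  unfolding hinge_loss_def sum.partition[OF assms(1,2)]
proof (rule sum.cong[OF refl])
  fix k assume "k \<in> C"
  with assms(3) consider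
      "\<forall>i\<in>k. margin_violation x y w b i \<le> 0" | "\<forall>i\<in>k. margin_violation x y w b i > 0"
    unfolding one_sided_def by blast
  then show "max 0 (\<Sum>i\<in>k. margin_violation x y w b i)
               = (\<Sum>i\<in>k. max 0 (margin_violation x y w b i))"
  proof cases
    case 1
    then have "(\<Sum>i\<in>k. margin_violation x y w b i) \<le> 0"
      by (simp add: sum_nonpos)
    with 1 show ?thesis
      by (simp add: max_absorb1)
  next
    case 2
    then have "(\<Sum>i\<in>k. margin_violation x y w b i) \<ge> 0"
      by (simp add: sum_nonneg less_imp_le)
    with 2 show ?thesis
      by (simp add: max_absorb2 less_imp_le)
  qed
qed

section \<open>Disaggregation is a refinement\<close>

lemma refines_UN:
  assumes C: "partition_on A C" and P: "\<And>k. k \<in> C \<Longrightarrow> partition_on k (P k)"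
  shows "refines A (\<Union>k\<in>C. P k) C"
proof -
  have Un: "\<Union>(P k) = k" if "k \<in> C" for k
    using partition_onD1[OF P[OF that]] by simp
  have sub: "p \<subseteq> k" if "k \<in> C" "p \<in> P k" for k p
    using Un[OF that(1)] that(2) by blast
  have "partition_on A (\<Union>k\<in>C. P k)"
  proof (rule partition_onI)
    have "\<Union>(\<Union>k\<in>C. P k) = (\<Union>k\<in>C. \<Union>(P k))"
      by blast
    also have "\<dots> = A"
      using Un partition_onD1[OF C] by simp
    finally show "\<Union>(\<Union>k\<in>C. P k) = A" .
    show "{} \<notin> (\<Union>k\<in>C. P k)"
      using partition_onD3[OF P] by blast
    fix p q
    assume "p \<in> (\<Union>k\<in>C. P k)" "q \<in> (\<Union>k\<in>C. P k)" and "p \<noteq> q"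
    then obtain k l where k: "k \<in> C" "p \<in> P k" and l: "l \<in> C" "q \<in> P l"
      by blast
    show "disjnt p q"
    proof (cases "k = l")
      case True
      then show ?thesis
        using pairwiseD[OF partition_onD2[OF P[OF k(1)]]] k(2) l(2) \<open>p \<noteq> q\<close> by blast
    next
      case False
      then have "disjnt k l"
        using pairwiseD[OF partition_onD2[OF C]] k(1) l(1) by blast
      then show ?thesis
        using sub[OF k] sub[OF l] by (meson disjnt_subset1 disjnt_subset2)
    qed
  qed
  with sub C show ?thesis
    unfolding refines_def by blast
qed

text \<open>Failure of both alternatives in \<open>one_sided\<close> gives an entry of each sign, so
  neither half is empty, as \<open>partition_on\<close> demands.\<close>

lemma partition_on_sign_split:
  assumes "\<not> one_sided x y w b k"
  shows "partition_on k {{i \<in> k. margin_violation x y w b i > 0},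
                         {i \<in> k. margin_violation x y w b i \<le> 0}}"
proof -
  have "\<exists>i\<in>k. margin_violation x y w b i > 0" "\<exists>i\<in>k. margin_violation x y w b i \<le> 0"
    using assms unfolding one_sided_def by (meson not_le)+
  then show ?thesis
    by (intro partition_onI) (auto simp: disjnt_iff)
qed

lemma disaggregate_refines:
  assumes "partition_on A C"
  shows "refines A (disaggregate x y w b C) C"
proof -
  \<comment> \<open>A cluster that is kept counts as split into the single piece \<open>k\<close>;
    this puts both cases of the update in the form required by \<open>refines_UN\<close>.\<close>
  let ?P = "\<lambda>k. if one_sided x y w b k then {k}
    else {{i \<in> k. margin_violation x y w b i > 0}, {i \<in> k. margin_violation x y w b i \<le> 0}}"
  have "disaggregate x y w b C = (\<Union>k\<in>C. ?P k)"
    unfolding disaggregate_def by (intro equalityI subsetI) (auto split: if_splits)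
  moreover have "partition_on k (?P k)" if "k \<in> C" for k
    using partition_on_sign_split partition_onD3[OF assms] that
    by (auto intro: partition_on_space)
  ultimately show ?thesis
    using refines_UN[OF assms, of ?P] by simp
qed

section \<open>Elimination of the slack variables\<close>

lemma sum_margin_violation:
  assumes "finite k" and "k \<noteq> {}" and "\<forall>i\<in>k. \<forall>j\<in>k. y i = y j"
  shows "(\<Sum>i\<in>k. margin_violation x y w b i)
           = real (card k) * (1 - cluster_mean y k * (w \<bullet> cluster_mean x k + b))"
proof -
  obtain j where "j \<in> k"
    using assms(2) by blast
  then have y: "y i = y j" if "i \<in> k" for i
    using assms(3) that by blast
  have card: "real (card k) > 0"
    using assms(1,2) by (simp add: card_gt_0_iff)
  \<comment> \<open>With one common label \<open>y j\<close> the violation is an affine function of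
    \<open>x i\<close> alone, so summing it amounts to evaluating it at the cluster means. With
    mixed labels the sum of \<open>y i * x i\<close> would not be determined by the means.\<close>
  have "(\<Sum>i\<in>k. y i) = real (card k) * y j"
    using y by simp
  then have mean: "cluster_mean y k = y j"
    using card by (simp add: cluster_mean_def)
  have "(\<Sum>i\<in>k. margin_violation x y w b i) = (\<Sum>i\<in>k. 1 - y j * (w \<bullet> x i + b))"
    using y by (intro sum.cong) (auto simp: margin_violation_def)
  also have "\<dots> = real (card k) - y j * (w \<bullet> (\<Sum>i\<in>k. x i) + real (card k) * b)"
    by (simp add: sum_subtractf sum_distrib_left[symmetric] sum.distrib inner_sum_right)
  also have "w \<bullet> (\<Sum>i\<in>k. x i) = real (card k) * (w \<bullet> cluster_mean x k)"
    using card by (simp add: cluster_mean_def)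
  finally show ?thesis
    by (simp add: mean algebra_simps)
qed

context
  fixes n :: nat and x :: "nat \<Rightarrow> real ^ 'm" and y :: "nat \<Rightarrow> real" and M :: real
  assumes M: "M \<ge> 0"
begin

definition agg_hinge_objective :: "nat set set \<Rightarrow> real ^ 'm \<Rightarrow> real \<Rightarrow> real" where
  "agg_hinge_objective C w b
     = 1 / 2 * (norm w)\<^sup>2 + M * hinge_loss (margin_violation x y w b) C"

lemma induced_value_eq:
  "induced_value n x y M w b
     = 1 / 2 * (norm w)\<^sup>2 + M * (\<Sum>i\<in>{1..n}. max 0 (margin_violation x y w b i))"
  by (simp add: induced_value_def svm_objective_def)

lemma agg_hinge_objective_refines:
  assumes "refines {1..n} D C"
  shows "agg_hinge_objective C w b \<le> agg_hinge_objective D w b"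
  using hinge_loss_refines[OF _ assms] M
  by (simp add: agg_hinge_objective_def mult_left_mono)

lemma agg_hinge_objective_le_induced_value:
  assumes "partition_on {1..n} C"
  shows "agg_hinge_objective C w b \<le> induced_value n x y M w b"
  using hinge_loss_le[OF _ assms] M
  by (simp add: agg_hinge_objective_def induced_value_eq mult_left_mono)

text \<open>For fixed \<open>(w, b)\<close> the positive part of the violation is the least feasible
  slack of each entry.\<close>

lemma svm_objective_ge_induced_value:
  assumes "svm_feasible n x y (w, b, \<xi>)"
  shows "induced_value n x y M w b \<le> svm_objective n M (w, b, \<xi>)"
proof -
  have "(\<Sum>i\<in>{1..n}. max 0 (margin_violation x y w b i)) \<le> (\<Sum>i\<in>{1..n}. \<bar>\<xi> i\<bar>)"
    using assms by (intro sum_mono) (force simp: svm_feasible_def margin_violation_def)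
  then show ?thesis
    using M by (simp add: induced_value_eq svm_objective_def mult_left_mono)
qed

lemma svm_feasible_induced:
  "svm_feasible n x y (w, b, \<lambda>i. max 0 (margin_violation x y w b i))"
  by (auto simp: svm_feasible_def margin_violation_def)

context
  fixes C :: "nat set set"
  assumes part: "partition_on {1..n} C" and lab: "uniform_labels y C"
begin

text \<open>The least feasible slack of a cluster, weighted by its size as in the aggregated
  objective, is its term in \<open>hinge_loss\<close>: the nonnegative factor \<open>card k\<close>
  may be moved inside the maximum.\<close>

lemma card_mult_mean_violation:
  assumes "k \<in> C"
  shows "real (card k) * max 0 (1 - cluster_mean y k * (w \<bullet> cluster_mean x k + b))
           = max 0 (\<Sum>i\<in>k. margin_violation x y w b i)"
proof -
  have "k \<subseteq> {1..n}" and "k \<noteq> {}"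
    using part assms by (auto simp: partition_on_def)
  moreover from this have "finite k"
    by (simp add: finite_subset)
  moreover have "\<forall>i\<in>k. \<forall>j\<in>k. y i = y j"
    using lab assms unfolding uniform_labels_def by blast
  ultimately have "(\<Sum>i\<in>k. margin_violation x y w b i)
      = real (card k) * (1 - cluster_mean y k * (w \<bullet> cluster_mean x k + b))"
    by (intro sum_margin_violation)
  then show ?thesis
    by (simp add: max_mult_distrib_left)
qed

lemma agg_objective_ge:
  assumes "agg_feasible x y C (w, b, \<xi>)"
  shows "agg_hinge_objective C w b \<le> agg_objective M C (w, b, \<xi>)"
proof -
  have "hinge_loss (margin_violation x y w b) C \<le> (\<Sum>k\<in>C. real (card k) * \<xi> k)"
    unfolding hinge_loss_def
  proof (rule sum_mono)
    fix k assume "k \<in> C"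
    with assms have "max 0 (1 - cluster_mean y k * (w \<bullet> cluster_mean x k + b)) \<le> \<xi> k"
      by (fastforce simp: agg_feasible_def)
    then show "max 0 (\<Sum>i\<in>k. margin_violation x y w b i) \<le> real (card k) * \<xi> k"
      unfolding card_mult_mean_violation[OF \<open>k \<in> C\<close>, symmetric] by (intro mult_left_mono) auto
  qed
  then show ?thesis
    using M by (simp add: agg_hinge_objective_def agg_objective_def mult_left_mono)
qed

text \<open>Taking the least feasible slack in every cluster turns the bound
  \<open>agg_objective_ge\<close> into an equality, so \<open>agg_hinge_objective\<close> is the
  minimum over the slacks for fixed \<open>(w, b)\<close>.\<close>

lemma agg_objective_attained:
  obtains \<xi> where "agg_feasible x y C (w, b, \<xi>)"
    and "agg_objective M C (w, b, \<xi>) = agg_hinge_objective C w b"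
proof
  let ?\<xi> = "\<lambda>k. max 0 (1 - cluster_mean y k * (w \<bullet> cluster_mean x k + b))"
  show "agg_feasible x y C (w, b, ?\<xi>)"
    by (auto simp: agg_feasible_def)
  show "agg_objective M C (w, b, ?\<xi>) = agg_hinge_objective C w b"
    by (simp add: agg_objective_def agg_hinge_objective_def hinge_loss_def card_mult_mean_violation)
qed

text \<open>Any competitor \<open>(w', b')\<close> can be completed by its least slacks to a
  feasible point, so optimality with slacks passes to the slack-free objective.\<close>

lemma agg_optimal:
  assumes "is_arg_min (agg_objective M C) (agg_feasible x y C) (w, b, \<xi>)"
  shows "agg_value x y M C = agg_hinge_objective C w b"
    and "agg_hinge_objective C w b \<le> agg_hinge_objective C w' b'"
proof -
  have feas: "agg_feasible x y C (w, b, \<xi>)"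
    and opt: "\<And>z. agg_feasible x y C z \<Longrightarrow> agg_objective M C (w, b, \<xi>) \<le> agg_objective M C z"
    using assms by (auto simp: is_arg_min_linorder)
  have le: "agg_objective M C (w, b, \<xi>) \<le> agg_hinge_objective C u c" for u c
    using opt agg_objective_attained[of u c] by metis
  have ge: "agg_hinge_objective C w b \<le> agg_objective M C (w, b, \<xi>)"
    using agg_objective_ge[OF feas] .
  show "agg_value x y M C = agg_hinge_objective C w b"
    unfolding agg_value_def min_value_eq[OF assms] using le[of w b] ge by (rule antisym)
  show "agg_hinge_objective C w b \<le> agg_hinge_objective C w' b'"
    using ge le by (rule order_trans)
qed

end

section \<open>Comparison of optimal values\<close>

lemma agg_value_refines:
  assumes "refines {1..n} D C" and "uniform_labels y C"
    and "is_arg_min (agg_objective M C) (agg_feasible x y C) (w, b, \<xi>)"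
    and "is_arg_min (agg_objective M D) (agg_feasible x y D) (w', b', \<xi>')"
  shows "agg_value x y M C \<le> agg_value x y M D"
proof -
  have C: "partition_on {1..n} C" and D: "partition_on {1..n} D" "uniform_labels y D"
    using assms(1) uniform_labels_refines[OF assms(1,2)] by (auto simp: refines_def)
  \<comment> \<open>The optimum of the finer problem is used as a competitor in the coarser
    one.\<close>
  have "agg_value x y M C \<le> agg_hinge_objective C w' b'"
    using agg_optimal[OF C assms(2,3)] by simp
  also have "\<dots> \<le> agg_hinge_objective D w' b'"
    using agg_hinge_objective_refines[OF assms(1)] .
  also have "\<dots> = agg_value x y M D"
    using agg_optimal(1)[OF D assms(4)] by simp
  finally show ?thesis .
qed

text \<open>Existence of an original minimizer is a conclusion here: the aggregated optimum, with
  induced slacks, attains the lower bound that the aggregated value puts on every feasible original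
  objective value.\<close>

lemma one_sided_optimal:
  assumes "partition_on {1..n} C" and "uniform_labels y C"
    and "is_arg_min (agg_objective M C) (agg_feasible x y C) (w, b, \<xi>)"
    and "\<forall>k\<in>C. one_sided x y w b k"
  shows "agg_value x y M C = induced_value n x y M w b"
    and "is_arg_min (svm_objective n M) (svm_feasible n x y)
           (w, b, \<lambda>i. max 0 (margin_violation x y w b i))"
proof -
  have eq: "agg_hinge_objective C w b = induced_value n x y M w b"
    using hinge_loss_one_sided[OF _ assms(1,4)]
    by (simp add: agg_hinge_objective_def induced_value_eq)
  then show "agg_value x y M C = induced_value n x y M w b"
    using agg_optimal(1)[OF assms(1-3)] by simp
  have "induced_value n x y M w b \<le> svm_objective n M (w', b', \<xi>')"
    if "svm_feasible n x y (w', b', \<xi>')" for w' b' \<xi>'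
    using eq agg_optimal(2)[OF assms(1-3)] agg_hinge_objective_le_induced_value[OF assms(1)]
      svm_objective_ge_induced_value[OF that] by (metis order_trans)
  then show "is_arg_min (svm_objective n M) (svm_feasible n x y)
           (w, b, \<lambda>i. max 0 (margin_violation x y w b i))"
    by (auto simp: is_arg_min_linorder svm_feasible_induced induced_value_def)
qed

end

section \<open>Runs of the algorithm\<close>

lemma aid_run_partition:
  assumes "aid_run n x y M C w b \<xi> T" and "t \<le> T"
  shows "partition_on {1..n} (C t) \<and> uniform_labels y (C t)"
  using assms(2)
proof (induction t)
  case 0
  then show ?case
    using assms(1) unfolding aid_run_def uniform_labels_def by blast
next
  case (Suc t)
  then have IH: "partition_on {1..n} (C t)" "uniform_labels y (C t)"
    by auto
  have "C (Suc t) = disaggregate x y (w t) (b t) (C t)"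
    using assms(1) Suc.prems unfolding aid_run_def by (meson Suc_le_lessD)
  then have "refines {1..n} (C (Suc t)) (C t)"
    using disaggregate_refines[OF IH(1)] by simp
  \<comment> \<open>New clusters lie inside old ones and inherit their common label.\<close>
  then show ?case
    using uniform_labels_refines IH(2) by (auto simp: refines_def)
qed

theorem proposition4:
  fixes n T :: nat and x :: "nat \<Rightarrow> real ^ 'm" and y :: "nat \<Rightarrow> real" and M :: real
    and C :: "nat \<Rightarrow> nat set set"
    and w :: "nat \<Rightarrow> real ^ 'm" and b :: "nat \<Rightarrow> real" and \<xi> :: "nat \<Rightarrow> nat set \<Rightarrow> real"
  assumes "\<And>i. i \<in> {1..n} \<Longrightarrow> y i \<in> {-1, 1}"
    and "M > 0"
    and "aid_run n x y M C w b \<xi> T"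
  shows "(\<forall>t\<in>{1..T}. agg_value x y M (C (t - 1)) \<le> agg_value x y M (C t)) \<and>
         agg_value x y M (C T) = induced_value n x y M (w T) (b T) \<and>
         induced_value n x y M (w T) (b T) = svm_value n x y M \<and>
         (\<exists>z. is_arg_min (svm_objective n M) (svm_feasible n x y) z)"
proof -
  have M: "M \<ge> 0"
    using assms(2) by simp
  note part = aid_run_partition[OF assms(3)]
  have opt: "is_arg_min (agg_objective M (C t)) (agg_feasible x y (C t)) (w t, b t, \<xi> t)"
    if "t \<le> T" for t
    using assms(3) that unfolding aid_run_def by blast
  have mono: "agg_value x y M (C (t - 1)) \<le> agg_value x y M (C t)" if t: "t \<in> {1..T}" for t
  proof -
    \<comment> \<open>Since \<open>t\<close> is at least 1, it has a predecessor \<open>s\<close>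
      strictly below \<open>T\<close>, the range in which a run prescribes the disaggregation
      step.\<close>
    from t obtain s where s: "t = Suc s" "s < T"
      by (cases t) auto
    have "C (Suc s) = disaggregate x y (w s) (b s) (C s)"
      using assms(3) s unfolding aid_run_def by blast
    then have "refines {1..n} (C (Suc s)) (C s)"
      using disaggregate_refines part[of s] s by auto
    then show ?thesis
      using agg_value_refines[OF M _ _ opt opt] part[of s] s by simp
  qed
  have "\<forall>k\<in>C T. one_sided x y (w T) (b T) k"
    using assms(3) unfolding aid_run_def by blast
  note final = one_sided_optimal[OF M _ _ opt[OF order_refl] this]
  \<comment> \<open>The minimizer found in \<open>final\<close> makes the \<open>LEAST\<close> in
    \<open>svm_value\<close> evaluate to its objective value.\<close>
  have "induced_value n x y M (w T) (b T) = svm_value n x y M"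
    using min_value_eq[OF final(2)] part[of T] by (simp add: svm_value_def induced_value_def)
  with mono final part[of T] show ?thesis
    by blast
qed

end
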